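(* Let $(D,B_0)$ be a dimaze (possibly infinite) and let $\mathcal I$ be the family of all linkable subsets of $V(D)$. Then $\mathcal I$ satisfies (I3): for every $I\in\mathcal I$ that is not inclusion-maximal in $\mathcal I$ and every inclusion-maximal element $I'$ of $\mathcal I$, there is an $x\in I'\setminus I$ such that $I\cup\{x\}\in\mathcal I$.
   Context: Dimazes: a dimaze is a pair $(D,B_0)$ where $D$ is a digraph (of arbitrary cardinality) and $B_0$ is a subset of the set of vertices of $D$ of out-degree $0$; the elements of $B_0$ are called exits. A linkage is a set $\mathcal P$ of pairwise (vertex-)disjoint finite directed paths (possibly trivial, i.e. consisting of a single vertex) in $D$, each of whose terminal vertices lies in $B_0$. A set $I\subseteq V(D)$ is linkable (or independent) if there is a linkage $\mathcal P$ such that the set of initial vertices of paths in $\mathcal P$ is exactly $I$. *)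

theory Defs
  imports "Graph_Theory.Vertex_Walk"
begin

(* Digraphs are wf_digraph: vertex and arc sets of arbitrary cardinality, loops and parallel
   arcs allowed.  Out-degree 0 is expressed by out_arcs being empty, because the library's
   out_degree is a natural-number cardinality and is also 0 for infinitely many outgoing arcs. *)
locale dimaze = wf_digraph D for D :: "('a, 'b) pre_digraph" +
  fixes B0 :: "'a set"
  assumes exits_subset: "B0 \<subseteq> {v \<in> verts D. out_arcs D v = {}}"

(* A directed path is a vpath, i.e. its nonempty list of distinct vertices; [v] is the trivial
   path at v.  Its initial vertex is hd p and its terminal vertex is last p.  Paths differing
   only in the choice of parallel arcs share their vertices, so at most one of them occurs in a
   set of disjoint paths and nothing is lost by recording vertices only. *)
definition linkage :: "('a, 'b) pre_digraph \<Rightarrow> 'a set \<Rightarrow> 'a vwalk set \<Rightarrow> bool" where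
  "linkage D B0 P \<longleftrightarrow>
     (\<forall>p\<in>P. vpath p D \<and> last p \<in> B0) \<and>
     pairwise (\<lambda>p q. disjnt (set p) (set q)) P"

definition linkable :: "('a, 'b) pre_digraph \<Rightarrow> 'a set \<Rightarrow> 'a set \<Rightarrow> bool" where
  "linkable D B0 I \<longleftrightarrow> I \<subseteq> verts D \<and> (\<exists>P. linkage D B0 P \<and> hd ` P = I)"

definition linkable_sets :: "('a, 'b) pre_digraph \<Rightarrow> 'a set \<Rightarrow> 'a set set" where
  "linkable_sets D B0 = {I. linkable D B0 I}"

definition maximal_in :: "'a set set \<Rightarrow> 'a set \<Rightarrow> bool" where
  "maximal_in F X \<longleftrightarrow> X \<in> F \<and> (\<forall>Y\<in>F. X \<subseteq> Y \<longrightarrow> Y = X)"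

definition axiom_I3 :: "'a set set \<Rightarrow> bool" where
  "axiom_I3 F \<longleftrightarrow>
     (\<forall>I I'. I \<in> F \<and> \<not> maximal_in F I \<and> maximal_in F I' \<longrightarrow> (\<exists>x \<in> I' - I. I \<union> {x} \<in> F))"

end

theory Submission
  imports Defs
begin

text \<open>
  A linkage of \<open>I\<close> onto \<open>T\<close> is encoded by its successor function \<open>g\<close>, extended by the
  identity off the paths; it maps \<open>V - T\<close> injectively into \<open>V - I\<close>.
  Let \<open>g\<close> come from a linkage of the non-maximal set \<open>I\<close> that misses an exit \<open>v\<^sub>0\<close>, and let
  \<open>R\<close> be the set of vertices from which an exit outside \<open>T\<close> can be reached by an alternating walk,
  whose steps \<open>u \<rightarrow> u'\<close> replace the value \<open>g u\<close> by \<open>g u'\<close>.  If some \<open>x \<in> I'\<close> lies in \<open>g ` R\<close>,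
  then a finite alternating walk turns \<open>g\<close> into a linkage of \<open>I \<union> {x}\<close>.  Otherwise the function
  that is \<open>g\<close> on \<open>R\<close> and the successor function of a linkage of \<open>I'\<close> off \<open>R\<close> is injective; it
  links \<open>I'\<close> and avoids \<open>v\<^sub>0\<close>, so \<open>I' \<union> {v\<^sub>0}\<close> is linkable, contradicting the maximality of \<open>I'\<close>.
\<close>

section \<open>From successor functions to linkages\<close>

text \<open>Fixed points outside \<open>T\<close> stand for vertices off the paths. An orbit from
  \<open>I\<close> may still be an infinite ray; reaching \<open>T\<close> is always argued
  separately.\<close>

definition routing :: "('a, 'b) pre_digraph \<Rightarrow> 'a set \<Rightarrow> 'a set \<Rightarrow> ('a \<Rightarrow> 'a) \<Rightarrow> bool" where
  "routing D T I g \<longleftrightarrow>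
     (\<forall>v \<in> verts D - T. g v \<in> verts D - I \<and> (g v = v \<or> (v, g v) \<in> arcs_ends D)) \<and>
     inj_on g (verts D - T)"

lemma routing_orbit_in_verts:
  assumes "routing D T I g" "i \<in> verts D" "\<And>m. m < n \<Longrightarrow> (g ^^ m) i \<notin> T"
  shows "(g ^^ n) i \<in> verts D"
  using assms(3)
proof (induction n)
  case (Suc n)
  then have "(g ^^ n) i \<in> verts D - T" by simp
  then show ?case using assms(1) by (auto simp: routing_def)
qed (use assms in simp)

text \<open>Injectivity lets both orbits be traced back in parallel from the common vertex; they
  reach their starts together, since no vertex of \<open>I\<close> is a value. The case
  \<open>i = j\<close> excludes repetitions within one orbit.\<close>

lemma routing_orbits_disjoint:
  assumes r: "routing D T I g" and "i \<in> I" "j \<in> I" "I \<subseteq> verts D"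
    and "\<And>m. m < a \<Longrightarrow> (g ^^ m) i \<notin> T" "\<And>m. m < b \<Longrightarrow> (g ^^ m) j \<notin> T"
    and "(g ^^ a) i = (g ^^ b) j"
  shows "a = b \<and> i = j"
  using assms(5-)
proof (induction a arbitrary: b)
  case 0
  show ?case
  proof (cases b)
    case (Suc b')
    have "(g ^^ b') j \<in> verts D - T"
      using routing_orbit_in_verts[OF r, of j b'] 0 Suc assms by auto
    then have "g ((g ^^ b') j) \<notin> I" using r by (auto simp: routing_def)
    then show ?thesis using 0 Suc assms by simp
  qed (use 0 in simp)
next
  case (Suc a)
  have a: "(g ^^ a) i \<in> verts D - T"
    using routing_orbit_in_verts[OF r, of i a] Suc assms by auto
  show ?case
  proof (cases b)
    case 0
    have "g ((g ^^ a) i) \<notin> I" using r a by (auto simp: routing_def)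
    then show ?thesis using 0 Suc assms by simp
  next
    case (Suc b')
    have b: "(g ^^ b') j \<in> verts D - T"
      using routing_orbit_in_verts[OF r, of j b'] Suc.prems Suc assms by auto
    have "g ((g ^^ a) i) = g ((g ^^ b') j)" using Suc.prems Suc by simp
    then have "(g ^^ a) i = (g ^^ b') j" using r a b by (auto simp: routing_def inj_on_def)
    then show ?thesis using Suc.IH[of b'] Suc.prems Suc by simp
  qed
qed

lemma set_vwalk_arcs_map_upt:
  "set (vwalk_arcs (map f [0..<Suc n])) = {(f m, f (Suc m)) |m. m < n}"
proof (induction n)
  case (Suc n)
  have "vwalk_arcs (map f [0..<Suc (Suc n)]) =
      vwalk_arcs (map f [0..<Suc n]) @ [(f n, f (Suc n))]"
    using vwalk_arcs_append[of "map f [0..<Suc n]" "[f (Suc n)]"] by simp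
  then show ?case using Suc by (auto simp: less_Suc_eq)
qed simp

text \<open>The paths are the orbits of \<open>I\<close>, cut at their first visit to
  \<open>T\<close>.\<close>

lemma linkable_if_routing:
  assumes r: "routing D T I g" and I: "I \<subseteq> verts D" and T: "T \<subseteq> B0"
    and ends: "\<And>i. i \<in> I \<Longrightarrow> \<exists>n. (g ^^ n) i \<in> T"
  shows "linkable D B0 I"
proof -
  define N where "N i = (LEAST n. (g ^^ n) i \<in> T)" for i
  define path where "path i = map (\<lambda>m. (g ^^ m) i) [0..<Suc (N i)]" for i
  have N: "(g ^^ N i) i \<in> T" if "i \<in> I" for i
    unfolding N_def using ends[OF that] by (rule LeastI_ex)
  have less: "(g ^^ m) i \<notin> T" if "m < N i" for m i
    using that not_less_Least unfolding N_def by blast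
  have inV: "(g ^^ m) i \<in> verts D" if "i \<in> I" "m \<le> N i" for m i
    using routing_orbit_in_verts[OF r, of i m] that I less by fastforce
  have disj: "a = b \<and> i = j"
    if "i \<in> I" "j \<in> I" "a \<le> N i" "b \<le> N j" "(g ^^ a) i = (g ^^ b) j" for a b i j
    using routing_orbits_disjoint[OF r that(1,2) I, of a b] that less by fastforce
  have set_path: "set (path i) = (\<lambda>m. (g ^^ m) i) ` {..N i}" for i
    unfolding path_def by (auto simp: atLeast0LessThan lessThan_Suc_atMost simp del: upt_Suc)
  have hd_path: "hd (path i) = i" for i
    by (simp add: path_def upt_conv_Cons del: upt_Suc)
  have "vpath (path i) D" if i: "i \<in> I" for i
  proof (intro vpathI vwalkI)
    show "set (path i) \<subseteq> verts D" using inV[OF i] set_path by auto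
    show "set (vwalk_arcs (path i)) \<subseteq> arcs_ends D"
    proof -
      have "((g ^^ m) i, (g ^^ Suc m) i) \<in> arcs_ends D" if m: "m < N i" for m
      proof -
        have "(g ^^ m) i \<in> verts D - T" using inV[OF i, of m] less m by auto
        \<comment> \<open>A fixed point would be a repetition, so the step must be an arc.\<close>
        moreover have "(g ^^ Suc m) i \<noteq> (g ^^ m) i" using disj[OF i i, of "Suc m" m] m by auto
        ultimately show ?thesis using r by (auto simp: routing_def)
      qed
      then show ?thesis unfolding path_def set_vwalk_arcs_map_upt by blast
    qed
    show "path i \<noteq> []" by (simp add: path_def)
    show "distinct (path i)"
      unfolding path_def distinct_map using disj[OF i i]
      by (auto simp: inj_on_def less_Suc_eq_le simp del: upt_Suc)
  qed
  moreover have "last (path i) \<in> B0" if "i \<in> I" for i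
    using N[OF that] T by (auto simp: path_def)
  moreover have "disjnt (set (path i)) (set (path j))" if "i \<in> I" "j \<in> I" "i \<noteq> j" for i j
    using disj[OF that(1,2)] that(3) by (auto simp: disjnt_def set_path)
  ultimately have "linkage D B0 (path ` I)"
    by (auto simp: linkage_def pairwise_def)
  moreover have "hd ` path ` I = I" by (simp add: image_image hd_path)
  ultimately show ?thesis using I unfolding linkable_def by blast
qed

text \<open>This records that the paths of a linkage are finite: every orbit becomes
  constant.\<close>

definition settles :: "('a \<Rightarrow> 'a) \<Rightarrow> bool" where
  "settles g \<longleftrightarrow> (\<forall>v. \<exists>n. g ((g ^^ n) v) = (g ^^ n) v)"

text \<open>The orbit of a start vertex outside \<open>T\<close> is injective, hence contains no fixed point.\<close>

lemma routing_orbit_terminates: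
  assumes r: "routing D T I h" and I: "I \<subseteq> verts D" "i \<in> I" and g: "settles g"
    and agree: "\<And>n. n \<ge> N \<Longrightarrow> (\<And>m. (h ^^ m) i \<notin> T) \<Longrightarrow> h ((h ^^ n) i) = g ((h ^^ n) i)"
  shows "\<exists>n. (h ^^ n) i \<in> T"
proof (rule ccontr)
  assume "\<nexists>n. (h ^^ n) i \<in> T"
  then have no: "(h ^^ n) i \<notin> T" for n by blast
  \<comment> \<open>From index \<open>N\<close> on, the orbit of \<open>h\<close> is an orbit of
    \<open>g\<close>, so it runs into a fixed point.\<close>
  have eq: "(g ^^ n) ((h ^^ N) i) = (h ^^ (N + n)) i" for n
    by (induction n) (use agree no in simp_all)
  obtain n where "g ((g ^^ n) ((h ^^ N) i)) = (g ^^ n) ((h ^^ N) i)"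
    using g unfolding settles_def by blast
  then have "(h ^^ Suc (N + n)) i = (h ^^ (N + n)) i"
    using agree[of "N + n"] no by (simp add: eq)
  then show False
    using routing_orbits_disjoint[OF r I(2) I(2) I(1), of "Suc (N + n)" "N + n"] no by simp
qed

section \<open>From linkages to successor functions\<close>

lemma nth_pair_in_vwalk_arcs:
  "Suc i < length p \<Longrightarrow> (p ! i, p ! Suc i) \<in> set (vwalk_arcs p)"
proof (induction p arbitrary: i rule: vwalk_arcs.induct)
  case (3 x y xs)
  then show ?case by (cases i) auto
qed auto

lemma linkage_index_unique:
  assumes "linkage D B0 P" "p \<in> P" "q \<in> P" "i < length p" "j < length q" "p ! i = q ! j"
  shows "p = q \<and> i = j"
proof -
  have "p = q"
  proof (rule ccontr)
    assume "p \<noteq> q"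
    then have "disjnt (set p) (set q)" using assms by (auto simp: linkage_def pairwise_def)
    then show False using assms(4-6) nth_mem unfolding disjnt_def by (metis IntI empty_iff)
  qed
  moreover have "distinct p" using assms by (auto simp: linkage_def vpath_def)
  ultimately show ?thesis using assms nth_eq_iff_index_eq by blast
qed

lemma routing_of_linkage:
  assumes P: "linkage D B0 P"
  obtains g where "routing D (last ` P) (hd ` P) g" "settles g"
    "\<And>v. v \<notin> \<Union>(set ` P) \<Longrightarrow> g v = v"
proof -
  define S where "S v w \<longleftrightarrow> (\<exists>p\<in>P. \<exists>i. Suc i < length p \<and> v = p ! i \<and> w = p ! Suc i)" for v w
  \<comment> \<open>The default makes terminal vertices fixed points too, which is why
    \<open>g\<close> settles.\<close>
  define g where "g v = (if \<exists>w. S v w then SOME w. S v w else v)" for v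
  have S_iff: "S v (g v)" if "S v w" for v w
    unfolding g_def using that by (auto intro: someI)
  have g_id: "g v = v" if "\<nexists>w. S v w" for v using that by (simp add: g_def)
  have path: "p \<noteq> []" "distinct p" "set p \<subseteq> verts D" "set (vwalk_arcs p) \<subseteq> arcs_ends D"
    if "p \<in> P" for p
    using P that by (auto simp: linkage_def vpath_def vwalk_def)
  note uniq = linkage_index_unique[OF P]
  have g_nth: "g (p ! i) = p ! Suc i" if p: "p \<in> P" "Suc i < length p" for p i
  proof -
    have "S (p ! i) (g (p ! i))" using S_iff p unfolding S_def by blast
    then obtain q j where "q \<in> P" "Suc j < length q" "p ! i = q ! j" "g (p ! i) = q ! Suc j"
      unfolding S_def by blast
    then show ?thesis using uniq[of p q i j] p by auto
  qed
  have S_D: "\<exists>p\<in>P. \<exists>i. Suc i < length p \<and> v = p ! i \<and> g v = p ! Suc i" if "g v \<noteq> v" for v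
    using that g_id S_iff unfolding S_def by metis
  have off: "g v = v" if "v \<notin> \<Union>(set ` P)" for v
    using S_D[of v] that by (metis Suc_lessD UN_I nth_mem)
  have on: "\<exists>p\<in>P. \<exists>i. Suc i < length p \<and> v = p ! i"
    if "v \<in> \<Union>(set ` P)" "v \<notin> last ` P" for v
  proof -
    obtain p i where p: "p \<in> P" "i < length p" "v = p ! i"
      using \<open>v \<in> \<Union>(set ` P)\<close> by (auto simp: in_set_conv_nth)
    have "i \<noteq> length p - 1" using p path(1) \<open>v \<notin> last ` P\<close> by (auto simp: last_conv_nth)
    then show ?thesis using p by (intro bexI[of _ p] exI[of _ i]) auto
  qed
  have "g v \<in> verts D - hd ` P \<and> (g v = v \<or> (v, g v) \<in> arcs_ends D)"
    if v: "v \<in> verts D - last ` P" for v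
  proof (cases "v \<in> \<Union>(set ` P)")
    case True
    then obtain p i where p: "p \<in> P" "Suc i < length p" "v = p ! i" using on v by blast
    have "g v = p ! Suc i" using g_nth p by simp
    moreover have "p ! Suc i \<noteq> hd q" if q: "q \<in> P" for q
      using uniq[of p q "Suc i" 0] p q path(1)[OF q] by (auto simp: hd_conv_nth)
    ultimately show ?thesis
      using path(3,4)[OF p(1)] p nth_pair_in_vwalk_arcs[OF p(2)] by (auto dest: nth_mem)
  next
    case False
    then have "v \<notin> hd ` P" using path(1) by (auto dest: hd_in_set)
    then show ?thesis using off[OF False] v by simp
  qed
  moreover have "inj_on g (verts D - last ` P)"
  proof (rule inj_onI)
    \<comment> \<open>Successors lie on paths, while vertices off the paths are their own
      values.\<close>
    have cross: False
      if "v \<in> \<Union>(set ` P)" "v \<notin> last ` P" "w \<notin> \<Union>(set ` P)" "g v = g w" for v w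
    proof -
      obtain p i where p: "p \<in> P" "Suc i < length p" "v = p ! i"
        using on \<open>v \<in> _\<close> \<open>v \<notin> _\<close> by blast
      then have "g v \<in> set p" using g_nth by simp
      then show False using off \<open>w \<notin> _\<close> \<open>g v = g w\<close> p(1) by auto
    qed
    fix v w assume v: "v \<in> verts D - last ` P" and w: "w \<in> verts D - last ` P" and eq: "g v = g w"
    consider "v \<in> \<Union>(set ` P)" "w \<in> \<Union>(set ` P)" | "v \<notin> \<Union>(set ` P)" "w \<notin> \<Union>(set ` P)"
      using cross v w eq by (metis DiffD2)
    then show "v = w"
    proof cases
      case 1
      then obtain p i q j where pq: "p \<in> P" "Suc i < length p" "v = p ! i"
        "q \<in> P" "Suc j < length q" "w = q ! j"
        using on v w by (metis DiffD2)
      then have "p ! Suc i = q ! Suc j" using g_nth eq by simp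
      then show ?thesis using uniq pq by blast
    next
      case 2
      then show ?thesis using off eq by simp
    qed
  qed
  ultimately have "routing D (last ` P) (hd ` P) g" by (auto simp: routing_def)
  moreover have "settles g"
    unfolding settles_def
  proof
    fix v
    show "\<exists>n. g ((g ^^ n) v) = (g ^^ n) v"
    proof (cases "v \<in> \<Union>(set ` P)")
      case True
      then obtain p i where p: "p \<in> P" "i < length p" "v = p ! i" by (auto simp: in_set_conv_nth)
      have "(g ^^ n) v = p ! (i + n)" if "i + n < length p" for n
        using that by (induction n) (use p g_nth in auto)
      from this[of "length p - 1 - i"] have l: "(g ^^ (length p - 1 - i)) v = p ! (length p - 1)"
        using p by simp
      have "g (p ! (length p - 1)) = p ! (length p - 1)"
      proof (rule ccontr)
        assume "g (p ! (length p - 1)) \<noteq> p ! (length p - 1)"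
        then obtain q j where "q \<in> P" "Suc j < length q" "p ! (length p - 1) = q ! j"
          using S_D by metis
        then show False using uniq[of p q "length p - 1" j] p by auto
      qed
      then show ?thesis using l by metis
    next
      case False
      then show ?thesis using off by (intro exI[of _ 0]) simp
    qed
  qed
  ultimately show thesis using that off by blast
qed

section \<open>Augmentation along alternating walks\<close>

text \<open>In a step \<open>u\<close> takes over the value of \<open>u'\<close>, which then needs a
  new one. If \<open>g u' = u\<close>, then \<open>u\<close> becomes a fixed point and leaves the
  paths.\<close>

definition alternating :: "('a, 'b) pre_digraph \<Rightarrow> 'a set \<Rightarrow> ('a \<Rightarrow> 'a) \<Rightarrow> ('a \<times> 'a) set" where
  "alternating D T g = {(u, u'). u \<in> verts D - T \<and> u' \<in> verts D - T \<and>
     (g u' = u \<or> (u, g u') \<in> arcs_ends D)}"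

text \<open>Along a shortest alternating walk the vertices still to be rerouted keep their value
  under \<open>g\<close>.\<close>

lemma routing_shift:
  assumes r: "routing D T I g" and u: "u \<in> verts D - T"
  shows "(u, w) \<in> alternating D T g ^^ n \<Longrightarrow> (\<And>m. m < n \<Longrightarrow> (u, w) \<notin> alternating D T g ^^ m) \<Longrightarrow>
    \<exists>h. routing D (insert w T) (insert (g u) I) h \<and> finite {v. h v \<noteq> g v} \<and>
      (\<forall>v. v \<noteq> w \<longrightarrow> (\<forall>m<n. (u, v) \<notin> alternating D T g ^^ m) \<longrightarrow> h v = g v)"
proof (induction n arbitrary: w)
  case 0
  then have "w = u" by simp
  \<comment> \<open>Giving up its value makes \<open>u\<close> an end and the freed vertex
    \<open>g u\<close> a start.\<close>
  moreover have "routing D (insert u T) (insert (g u) I) g"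
    using r u by (auto simp: routing_def inj_on_def)
  ultimately show ?case by (intro exI[of _ g]) auto
next
  case (Suc n)
  let ?A = "alternating D T g"
  obtain w' where w': "(u, w') \<in> ?A ^^ n" "(w', w) \<in> ?A" using Suc.prems(1) by auto
  have "(u, w') \<notin> ?A ^^ m" if "m < n" for m
    using Suc.prems(2)[of "Suc m"] that w'(2) by auto
  then obtain h where h: "routing D (insert w' T) (insert (g u) I) h" "finite {v. h v \<noteq> g v}"
    "\<And>v. v \<noteq> w' \<Longrightarrow> (\<forall>m<n. (u, v) \<notin> ?A ^^ m) \<Longrightarrow> h v = g v"
    using Suc.IH[OF w'(1)] by blast
  have ww': "w \<noteq> w'" using Suc.prems(2)[of n] w'(1) by blast
  have hw: "h w = g w" using h(3)[OF ww'] Suc.prems(2) by simp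
  have inV: "w \<in> verts D - T" "w' \<in> verts D - T" "g w = w' \<or> (w', g w) \<in> arcs_ends D"
    using w'(2) by (auto simp: alternating_def)
  \<comment> \<open>The end moves from \<open>w'\<close> to \<open>w\<close>: \<open>w\<close> still
    has its old value, passes it to \<open>w'\<close>, and becomes exempt itself.\<close>
  have "routing D (insert w T) (insert (g u) I) (h(w' := g w))"
    using h(1) inV ww' unfolding routing_def inj_on_def hw[symmetric] by auto
  moreover have "finite {v. (h(w' := g w)) v \<noteq> g v}"
    by (rule finite_subset[OF _ finite.insertI[OF h(2), of w']]) auto
  moreover have "(h(w' := g w)) v = g v"
    if "v \<noteq> w" "\<forall>m<Suc n. (u, v) \<notin> ?A ^^ m" for v
    using h(3)[of v] that w'(1) by auto
  ultimately show ?case by blast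
qed

text \<open>A finite walk changes only finitely many values. An orbit missing all ends is injective,
  so it eventually leaves the changed vertices and follows \<open>g\<close>, which settles.\<close>

lemma linkable_augment:
  assumes r: "routing D T I g" and g: "settles g" and I: "I \<subseteq> verts D" and T: "T \<subseteq> B0"
    and walk: "(u, w) \<in> (alternating D T g)\<^sup>*" and u: "u \<in> verts D - T" and w: "w \<in> B0"
  shows "linkable D B0 (insert (g u) I)"
proof -
  let ?A = "alternating D T g"
  define n where "n = (LEAST n. (u, w) \<in> ?A ^^ n)"
  have "(u, w) \<in> ?A ^^ n"
    unfolding n_def by (rule LeastI_ex) (use walk rtrancl_imp_relpow in blast)
  moreover have "(u, w) \<notin> ?A ^^ m" if "m < n" for m
    using that not_less_Least unfolding n_def by blast
  ultimately obtain h where h: "routing D (insert w T) (insert (g u) I) h"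
    and fin: "finite {v. h v \<noteq> g v}"
    using routing_shift[OF r u] by blast
  have J: "insert (g u) I \<subseteq> verts D" using r u I by (auto simp: routing_def)
  show ?thesis
  proof (rule linkable_if_routing[OF h J])
    show "insert w T \<subseteq> B0" using w T by simp
    fix i assume i: "i \<in> insert (g u) I"
    show "\<exists>n. (h ^^ n) i \<in> insert w T"
    proof (rule ccontr)
      assume no: "\<nexists>n. (h ^^ n) i \<in> insert w T"
      then have "inj (\<lambda>n. (h ^^ n) i)"
        using routing_orbits_disjoint[OF h i i J] by (intro injI) blast
      then have "finite {n. (h ^^ n) i \<in> {v. h v \<noteq> g v}}"
        using finite_vimageI[OF fin] by (simp add: vimage_def)
      then obtain N where "\<And>n. (h ^^ n) i \<in> {v. h v \<noteq> g v} \<Longrightarrow> n < N"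
        unfolding finite_nat_set_iff_bounded by blast
      then have "h ((h ^^ n) i) = g ((h ^^ n) i)" if "n \<ge> N" for n using that by force
      then show False using routing_orbit_terminates[OF h J i g, of N] no by blast
    qed
  qed
qed

section \<open>Splicing two successor functions\<close>

lemma linkable_avoiding:
  assumes g: "routing D T I g" "settles g" and k: "routing D T' I' k" "settles k"
    and T: "T \<subseteq> B0" "T' \<subseteq> B0" and v0: "v0 \<in> B0" "v0 \<in> verts D" "v0 \<notin> T" "g v0 = v0"
    and I': "I' \<subseteq> verts D"
    and R: "R = {u \<in> verts D - T. \<exists>w \<in> B0 - T. (u, w) \<in> (alternating D T g)\<^sup>*}"
    and disj: "g ` R \<inter> I' = {}"
  shows "linkable D B0 (insert v0 I') \<and> v0 \<notin> I'"
proof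
  define f where "f v = (if v \<in> R then g v else k v)" for v
  have f_R: "f v = g v" if "v \<in> R" for v using that by (simp add: f_def)
  have f_notR: "f v = k v" if "v \<notin> R" for v using that by (simp add: f_def)
  have v0R: "v0 \<in> R" using v0 R by auto
  then have "v0 \<in> g ` R" using v0(4) by force
  then show "v0 \<notin> I'" using disj by blast
  have RV: "R \<subseteq> verts D - T" using R by auto
  have pred: "u \<in> R" if "u \<in> verts D - T" "u' \<in> R" "g u' = u \<or> (u, g u') \<in> arcs_ends D" for u u'
  proof -
    have "(u, u') \<in> alternating D T g" using that RV by (auto simp: alternating_def)
    then show ?thesis using that R by (auto intro: converse_rtrancl_into_rtrancl)
  qed
  \<comment> \<open>An exit outside \<open>T\<close> is in \<open>R\<close> by the trivial
    walk.\<close>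
  have offR: "v \<in> verts D - T'" if "v \<in> verts D - T" "v \<notin> R" for v
    using that R T by auto
  have k_out: "k v \<notin> g ` R" if v: "v \<in> verts D - T" "v \<notin> R" for v
  proof
    assume "k v \<in> g ` R"
    then obtain u' where u': "u' \<in> R" "g u' = k v" by auto
    have "k v = v \<or> (v, k v) \<in> arcs_ends D" using k(1) offR[OF v] by (auto simp: routing_def)
    then show False using pred[OF v(1) u'(1)] u'(2) v(2) by auto
  qed
  have ginj: "inj_on g (verts D - T)" and kinj: "inj_on k (verts D - T')"
    using g(1) k(1) by (auto simp: routing_def)
  have "f v \<in> verts D - insert v0 I' \<and> (f v = v \<or> (v, f v) \<in> arcs_ends D)"
    if v: "v \<in> verts D - insert v0 T" for v
  proof (cases "v \<in> R")
    case True
    have "g v \<noteq> v0" using ginj v v0 by (metis DiffD1 DiffD2 DiffI inj_onD insertCI)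
    moreover have "g v \<notin> I'" using disj True by blast
    ultimately show ?thesis using True g(1) v by (auto simp: f_def routing_def)
  next
    case False
    then have "k v \<noteq> v0" using k_out[of v] v \<open>v0 \<in> g ` R\<close> by auto
    then show ?thesis using False k(1) offR[of v] v by (auto simp: f_def routing_def)
  qed
  moreover have "inj_on f (verts D - insert v0 T)"
  proof (rule inj_onI)
    fix v w assume vw: "v \<in> verts D - insert v0 T" "w \<in> verts D - insert v0 T" "f v = f w"
    have "k v' \<noteq> g u" if "v' \<in> verts D - insert v0 T" "v' \<notin> R" "u \<in> R" for v' u
      using k_out[of v'] that by blast
    then have "v \<in> R \<longleftrightarrow> w \<in> R" using vw unfolding f_def by metis
    then show "v = w"
      using vw inj_onD[OF ginj, of v w] inj_onD[OF kinj, of v w] offR[of v] offR[of w]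
      by (auto simp: f_def split: if_splits)
  qed
  \<comment> \<open>As both start and end, \<open>v0\<close> carries a trivial path.\<close>
  ultimately have f: "routing D (insert v0 T) (insert v0 I') f" by (auto simp: routing_def)
  have J: "insert v0 I' \<subseteq> verts D" using I' v0 by simp
  show "linkable D B0 (insert v0 I')"
  proof (rule linkable_if_routing[OF f J])
    show "insert v0 T \<subseteq> B0" using v0 T by simp
    fix i assume i: "i \<in> insert v0 I'"
    show "\<exists>n. (f ^^ n) i \<in> insert v0 T"
    proof (cases "\<exists>N. (f ^^ N) i \<in> R")
      case True
      then obtain N where N: "(f ^^ N) i \<in> R" by blast
      show ?thesis
      proof (rule routing_orbit_terminates[OF f J i g(2)])
        fix n assume "n \<ge> N" and no: "\<And>m. (f ^^ m) i \<notin> insert v0 T"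
        from \<open>n \<ge> N\<close> have "(f ^^ n) i \<in> R"
        proof (induction n rule: dec_induct)
          case (step n)
          \<comment> \<open>With \<open>x\<close> the current vertex, \<open>g x = f x\<close> makes
            \<open>(f x, x)\<close> an alternating step, so \<open>f x\<close> is again in
            \<open>R\<close>.\<close>
          have "f ((f ^^ n) i) \<in> verts D - T"
            using no[of "Suc n"] routing_orbit_in_verts[OF f, of i "Suc n"] i J no by auto
          moreover have "g ((f ^^ n) i) = f ((f ^^ n) i)" using f_R[OF step.IH] by simp
          ultimately show ?case using pred[of _ "(f ^^ n) i"] step.IH by simp
        qed (use N in simp)
        then show "f ((f ^^ n) i) = g ((f ^^ n) i)" by (rule f_R)
      qed
    next
      case False
      then show ?thesis
        by (intro routing_orbit_terminates[OF f J i k(2), of 0]) (auto intro: f_notR)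
    qed
  qed
qed

theorem lemma2p2:
  fixes D :: "('a, 'b) pre_digraph" and B0 :: "'a set"
  assumes "dimaze D B0"
  shows "axiom_I3 (linkable_sets D B0)"
  unfolding axiom_I3_def
proof (intro allI impI, elim conjE)
  fix I I'
  assume "I \<in> linkable_sets D B0" "\<not> maximal_in (linkable_sets D B0) I"
    and max: "maximal_in (linkable_sets D B0) I'"
  then obtain Y y where Y: "linkable D B0 Y" "I \<subseteq> Y" "y \<in> Y" "y \<notin> I"
    unfolding maximal_in_def linkable_sets_def by blast
  then obtain PY where PY: "linkage D B0 PY" "hd ` PY = Y" by (auto simp: linkable_def)
  obtain Q where Q: "linkage D B0 Q" "hd ` Q = I'" and I': "I' \<subseteq> verts D"
    using max by (auto simp: maximal_in_def linkable_sets_def linkable_def)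
  obtain py where py: "py \<in> PY" "hd py = y" using PY Y by auto
  define P where "P = {p \<in> PY. hd p \<in> I}"
  define v0 where "v0 = last py"
  have P: "linkage D B0 P" using PY(1) by (auto simp: linkage_def P_def pairwise_def)
  have hdP: "hd ` P = I" using PY(2) Y(2) by (auto simp: P_def)
  have path: "p \<noteq> []" "set p \<subseteq> verts D" "last p \<in> B0" if "p \<in> PY" for p
    using PY(1) that by (auto simp: linkage_def vpath_def vwalk_def)
  have "v0 \<in> set py" using path py by (simp add: v0_def)
  have off: "v0 \<notin> \<Union>(set ` P)"
  proof
    assume "v0 \<in> \<Union>(set ` P)"
    then obtain p where p: "p \<in> PY" "hd p \<in> I" "v0 \<in> set p" by (auto simp: P_def)
    then have "p \<noteq> py" using py Y by auto
    then have "disjnt (set p) (set py)" using PY(1) p py by (auto simp: linkage_def pairwise_def)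
    then show False using p \<open>v0 \<in> set py\<close> by (auto simp: disjnt_def)
  qed
  then have v0: "v0 \<in> B0" "v0 \<in> verts D" "v0 \<notin> last ` P"
    using path[OF py(1)] \<open>v0 \<in> set py\<close> path(1) by (auto simp: v0_def P_def)
  obtain g where g: "routing D (last ` P) I g" "settles g" "\<And>v. v \<notin> \<Union>(set ` P) \<Longrightarrow> g v = v"
    using routing_of_linkage[OF P] unfolding hdP by blast
  obtain k where k: "routing D (last ` Q) I' k" "settles k"
    using routing_of_linkage[OF Q(1)] unfolding Q(2) by blast
  have T: "last ` P \<subseteq> B0" "last ` Q \<subseteq> B0" using P Q by (auto simp: linkage_def)
  have I: "I \<subseteq> verts D" using Y by (auto simp: linkable_def)
  define R where "R = {u \<in> verts D - last ` P.
    \<exists>w \<in> B0 - last ` P. (u, w) \<in> (alternating D (last ` P) g)\<^sup>*}"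
  show "\<exists>x\<in>I' - I. I \<union> {x} \<in> linkable_sets D B0"
  proof (cases "g ` R \<inter> I' = {}")
    case True
    have "linkable D B0 (insert v0 I') \<and> v0 \<notin> I'"
      by (rule linkable_avoiding[OF g(1,2) k T v0 g(3)[OF off] I' R_def True])
    \<comment> \<open>This case contradicts the maximality of \<open>I'\<close>.\<close>
    then show ?thesis using max unfolding maximal_in_def linkable_sets_def by blast
  next
    case False
    then obtain u where u: "u \<in> R" "g u \<in> I'" by auto
    then obtain w where w: "w \<in> B0" "(u, w) \<in> (alternating D (last ` P) g)\<^sup>*"
      and uV: "u \<in> verts D - last ` P" by (auto simp: R_def)
    have "linkable D B0 (insert (g u) I)"
      by (rule linkable_augment[OF g(1,2) I T(1) w(2) uV w(1)])
    moreover have "g u \<notin> I" using g(1) uV by (auto simp: routing_def)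
    ultimately show ?thesis using u(2) by (auto simp: linkable_sets_def)
  qed
qed

end
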